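(* For any set $\Omega$, the free monoid $\Omega^*$ is coherent; that is, every finitely generated subact of every finitely presented right $\Omega^*$-act is finitely presented, and every finitely generated subact of every finitely presented left $\Omega^*$-act is finitely presented.
   Context: $\Omega^*$ denotes the free monoid on $\Omega$ (all finite words over $\Omega$ under concatenation, with identity the empty word $\epsilon$). For a monoid $S$, a right $S$-act is a set $A$ with a map $A\times S\to A$, $(a,s)\mapsto as$, such that $a1=a$ and $a(st)=(as)t$ for all $a\in A$, $s,t\in S$; left $S$-acts are defined dually. A subact is a subset closed under the action. An act is finitely generated if it is generated by a finite subset, and finitely presented if it is isomorphic to a quotient of a finitely generated free $S$-act by a finitely generated congruence (a congruence on an act being an equivalence relation compatible with the action). A monoid $S$ is right (left) coherent if every finitely generated subact of every finitely presented right (left) $S$-act is finitely presented; $S$ is coherent if it is both right and left coherent. *)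

theory Defs
  imports "HOL-Algebra.Group"
begin

definition free_monoid :: "'a set \<Rightarrow> 'a list monoid" where
  "free_monoid \<Omega> = \<lparr>carrier = lists \<Omega>, mult = (@), one = []\<rparr>"

lemma monoid_free_monoid: "monoid (free_monoid \<Omega>)"
  by (rule monoidI) (auto simp: free_monoid_def)

text \<open>
  The action of an act with underlying set \<open>A\<close> is a function \<open>f :: 's \<Rightarrow> 'b \<Rightarrow> 'b\<close>. For a right act,
  \<open>f s a\<close> stands for \<open>as\<close>; for a left act, it stands for \<open>sa\<close>. The two kinds of act differ only in the
  order in which a product acts. Acts may be empty.
\<close>

locale right_act = monoid S
  for S :: "('s, 'm) monoid_scheme" (structure) and A :: "'b set" and f :: "'s \<Rightarrow> 'b \<Rightarrow> 'b" +
  assumes act_closed: "\<lbrakk>s \<in> carrier S; a \<in> A\<rbrakk> \<Longrightarrow> f s a \<in> A"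
    and act_one: "a \<in> A \<Longrightarrow> f \<one> a = a"
    and act_mult: "\<lbrakk>s \<in> carrier S; t \<in> carrier S; a \<in> A\<rbrakk> \<Longrightarrow> f (s \<otimes> t) a = f t (f s a)"

locale left_act = monoid S
  for S :: "('s, 'm) monoid_scheme" (structure) and A :: "'b set" and f :: "'s \<Rightarrow> 'b \<Rightarrow> 'b" +
  assumes act_closed: "\<lbrakk>s \<in> carrier S; a \<in> A\<rbrakk> \<Longrightarrow> f s a \<in> A"
    and act_one: "a \<in> A \<Longrightarrow> f \<one> a = a"
    and act_mult: "\<lbrakk>s \<in> carrier S; t \<in> carrier S; a \<in> A\<rbrakk> \<Longrightarrow> f (s \<otimes> t) a = f s (f t a)"

text \<open>The following notions do not depend on the side of the action.\<close>

definition subact ::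
    "('s, 'm) monoid_scheme \<Rightarrow> 'b set \<Rightarrow> ('s \<Rightarrow> 'b \<Rightarrow> 'b) \<Rightarrow> 'b set \<Rightarrow> bool" where
  "subact S A f B \<longleftrightarrow> B \<subseteq> A \<and> (\<forall>s\<in>carrier S. \<forall>b\<in>B. f s b \<in> B)"

definition generated_subact ::
    "('s, 'm) monoid_scheme \<Rightarrow> 'b set \<Rightarrow> ('s \<Rightarrow> 'b \<Rightarrow> 'b) \<Rightarrow> 'b set \<Rightarrow> 'b set" where
  "generated_subact S A f X = \<Inter>{B. subact S A f B \<and> X \<subseteq> B}"

definition finitely_generated_act ::
    "('s, 'm) monoid_scheme \<Rightarrow> 'b set \<Rightarrow> ('s \<Rightarrow> 'b \<Rightarrow> 'b) \<Rightarrow> bool" where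
  "finitely_generated_act S A f \<longleftrightarrow> (\<exists>X. finite X \<and> X \<subseteq> A \<and> generated_subact S A f X = A)"

definition act_congruence ::
    "('s, 'm) monoid_scheme \<Rightarrow> 'b set \<Rightarrow> ('s \<Rightarrow> 'b \<Rightarrow> 'b) \<Rightarrow> ('b \<times> 'b) set \<Rightarrow> bool" where
  "act_congruence S A f r \<longleftrightarrow>
     equiv A r \<and> (\<forall>s\<in>carrier S. \<forall>a b. (a, b) \<in> r \<longrightarrow> (f s a, f s b) \<in> r)"

definition generated_congruence ::
    "('s, 'm) monoid_scheme \<Rightarrow> 'b set \<Rightarrow> ('s \<Rightarrow> 'b \<Rightarrow> 'b) \<Rightarrow> ('b \<times> 'b) set \<Rightarrow> ('b \<times> 'b) set" where
  "generated_congruence S A f H = \<Inter>{r. act_congruence S A f r \<and> H \<subseteq> r}"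

definition finitely_generated_congruence ::
    "('s, 'm) monoid_scheme \<Rightarrow> 'b set \<Rightarrow> ('s \<Rightarrow> 'b \<Rightarrow> 'b) \<Rightarrow> ('b \<times> 'b) set \<Rightarrow> bool" where
  "finitely_generated_congruence S A f r \<longleftrightarrow>
     (\<exists>H. finite H \<and> H \<subseteq> A \<times> A \<and> r = generated_congruence S A f H)"

text \<open>The action induced on the quotient \<open>A // r\<close>: the class of \<open>a\<close> is sent to the class of \<open>f s a\<close>.\<close>

definition quotient_action :: "('b \<times> 'b) set \<Rightarrow> ('s \<Rightarrow> 'b \<Rightarrow> 'b) \<Rightarrow> 's \<Rightarrow> 'b set \<Rightarrow> 'b set" where
  "quotient_action r f s C = (\<Union>a\<in>C. r `` {f s a})"

definition act_isomorphic ::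
    "('s, 'm) monoid_scheme \<Rightarrow> 'b set \<Rightarrow> ('s \<Rightarrow> 'b \<Rightarrow> 'b) \<Rightarrow> 'c set \<Rightarrow> ('s \<Rightarrow> 'c \<Rightarrow> 'c) \<Rightarrow> bool" where
  "act_isomorphic S A f B g \<longleftrightarrow>
     (\<exists>h. bij_betw h A B \<and> (\<forall>s\<in>carrier S. \<forall>a\<in>A. h (f s a) = g s (h a)))"

text \<open>
  The free act on a set \<open>X\<close>, on either side, has underlying set \<open>X \<times> S\<close>, with \<open>S\<close> acting by
  multiplication on the second component; \<open>x \<in> X\<close> is identified with the pair \<open>(x, 1)\<close>. Up to
  isomorphism, the finitely generated free acts are those on the sets \<open>{..<n}\<close> with \<open>n :: nat\<close>.
\<close>

definition free_act :: "('s, 'm) monoid_scheme \<Rightarrow> 'x set \<Rightarrow> ('x \<times> 's) set" where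
  "free_act S X = X \<times> carrier S"

definition free_right_action :: "('s, 'm) monoid_scheme \<Rightarrow> 's \<Rightarrow> 'x \<times> 's \<Rightarrow> 'x \<times> 's" where
  "free_right_action S s p = (fst p, snd p \<otimes>\<^bsub>S\<^esub> s)"

definition free_left_action :: "('s, 'm) monoid_scheme \<Rightarrow> 's \<Rightarrow> 'x \<times> 's \<Rightarrow> 'x \<times> 's" where
  "free_left_action S s p = (fst p, s \<otimes>\<^bsub>S\<^esub> snd p)"

definition finitely_presented_right_act ::
    "('s, 'm) monoid_scheme \<Rightarrow> 'b set \<Rightarrow> ('s \<Rightarrow> 'b \<Rightarrow> 'b) \<Rightarrow> bool" where
  "finitely_presented_right_act S A f \<longleftrightarrow>
     right_act S A f \<and>
     (\<exists>(n::nat) r.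
        finitely_generated_congruence S (free_act S {..<n}) (free_right_action S) r \<and>
        act_isomorphic S A f (free_act S {..<n} // r) (quotient_action r (free_right_action S)))"

definition finitely_presented_left_act ::
    "('s, 'm) monoid_scheme \<Rightarrow> 'b set \<Rightarrow> ('s \<Rightarrow> 'b \<Rightarrow> 'b) \<Rightarrow> bool" where
  "finitely_presented_left_act S A f \<longleftrightarrow>
     left_act S A f \<and>
     (\<exists>(n::nat) r.
        finitely_generated_congruence S (free_act S {..<n}) (free_left_action S) r \<and>
        act_isomorphic S A f (free_act S {..<n} // r) (quotient_action r (free_left_action S)))"

text \<open>
  HOL cannot quantify over types inside a definition, so coherence takes as a parameter the type
  \<open>'b\<close> containing the underlying sets of the acts. A theorem stated for an arbitrary type \<open>'b\<close>
  covers all acts.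
\<close>

definition right_coherent :: "'b itself \<Rightarrow> ('s, 'm) monoid_scheme \<Rightarrow> bool" where
  "right_coherent T S \<longleftrightarrow> monoid S \<and>
     (\<forall>(A::'b set) f B.
        finitely_presented_right_act S A f \<and> subact S A f B \<and> finitely_generated_act S B f \<longrightarrow>
        finitely_presented_right_act S B f)"

definition left_coherent :: "'b itself \<Rightarrow> ('s, 'm) monoid_scheme \<Rightarrow> bool" where
  "left_coherent T S \<longleftrightarrow> monoid S \<and>
     (\<forall>(A::'b set) f B.
        finitely_presented_left_act S A f \<and> subact S A f B \<and> finitely_generated_act S B f \<longrightarrow>
        finitely_presented_left_act S B f)"

definition coherent :: "'b itself \<Rightarrow> ('s, 'm) monoid_scheme \<Rightarrow> bool" where
  "coherent T S \<longleftrightarrow> right_coherent T S \<and> left_coherent T S"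

end

theory Submission
  imports Defs
begin

text \<open>
  View a right act over a free monoid as a directed graph: every element \<open>a\<close> and every letter \<open>x\<close>
  give an edge \<open>(a, x)\<close> from \<open>a\<close> to \<open>ax\<close>. In a free act every element is the end of at most one edge.
  Call an edge colliding if some other edge has the same end. The theorem rests on the criterion
  \<open>finitely_presented_right_act_iff\<close>: a finitely generated act is finitely presented if and only if
  it has only finitely many colliding edges. An edge of a subact that collides there also collides in
  the whole act, so the condition passes from an act to all its subacts, and coherence follows.

  That a finite presentation leaves only finitely many collisions is \<open>finite_colliding_edges\<close>. Two
  words become equal in the act through a chain of steps, each of which replaces a prefix by the other
  side of a relation. Only a step that replaces the whole word can change the last edge of the path
  that the word describes, and then this last edge belongs to one of the finitely many words in the
  relations. Hence colliding edges are among the last edges of these words.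

  The converse is \<open>finitely_presented_if_finite_colliding_edges\<close>. Choose for every element a shortest
  word that leads to it from a generator. It suffices to impose that following the edge \<open>(b, x)\<close> after
  the word chosen for \<open>b\<close> amounts to the word chosen for \<open>bx\<close>, for those \<open>(b, x)\<close> that collide or end in
  a generator; there are finitely many of them. All other edges are the only way into their end, so
  that every word leading there uses them.

  The two sides are treated together: a left act is a right act over the opposite monoid, and the
  opposite of a free monoid is again free on the same letters.
\<close>

section \<open>Finite presentations as equivariant surjections\<close>

text \<open>The kernel of \<open>\<pi>\<close>, restricted to \<open>P\<close> so that it is an equivalence relation on \<open>P\<close>.\<close>

definition same_image :: "'p set \<Rightarrow> ('p \<Rightarrow> 'b) \<Rightarrow> ('p \<times> 'p) set" where
  "same_image P \<pi> = {(p, q). p \<in> P \<and> q \<in> P \<and> \<pi> p = \<pi> q}"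

lemma act_congruence_generated_congruence:
  assumes "\<And>s a. s \<in> carrier S \<Longrightarrow> a \<in> A \<Longrightarrow> f s a \<in> A" and "H \<subseteq> A \<times> A"
  shows "act_congruence S A f (generated_congruence S A f H)"
proof -
  define R where "R = {r. act_congruence S A f r \<and> H \<subseteq> r}"
  have G: "generated_congruence S A f H = \<Inter>R"
    by (simp add: R_def generated_congruence_def)
  have top: "A \<times> A \<in> R"
    using assms by (auto simp: R_def act_congruence_def equiv_def refl_on_def sym_def trans_def)
  have R: "equiv A r" "\<And>s a b. s \<in> carrier S \<Longrightarrow> (a, b) \<in> r \<Longrightarrow> (f s a, f s b) \<in> r"
    if "r \<in> R" for r
    using that by (auto simp: R_def act_congruence_def)
  have "equiv A (\<Inter>R)"
  proof (rule equivI)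
    show "\<Inter>R \<subseteq> A \<times> A" using top by blast
    show "refl_on A (\<Inter>R)"
      using R(1) by (auto simp: equiv_def refl_on_def)
    show "sym (\<Inter>R)"
      using R(1) by (auto simp: equiv_def intro!: symI dest: symD)
    show "trans (\<Inter>R)"
      using R(1) by (simp add: equiv_def trans_INTER[where r="\<lambda>r. r", simplified])
  qed
  then show ?thesis
    unfolding G act_congruence_def using R(2) by auto
qed

lemma generated_congruence_least:
  assumes "act_congruence S A f r" and "H \<subseteq> r"
  shows "generated_congruence S A f H \<subseteq> r"
  using assms by (auto simp: generated_congruence_def)

lemma subset_generated_congruence: "H \<subseteq> generated_congruence S A f H"
  by (auto simp: generated_congruence_def)

lemma act_congruence_same_image:
  assumes "\<And>s p. s \<in> carrier S \<Longrightarrow> p \<in> P \<Longrightarrow> g s p \<in> P"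
    and "\<And>s p. s \<in> carrier S \<Longrightarrow> p \<in> P \<Longrightarrow> \<pi> (g s p) = f s (\<pi> p)"
  shows "act_congruence S P g (same_image P \<pi>)"
  using assms
  by (auto simp: act_congruence_def same_image_def equiv_def refl_on_def sym_def trans_def)

lemma quotient_action_class:
  assumes "act_congruence S P g r" and "s \<in> carrier S" and "p \<in> P"
  shows "quotient_action r g s (r `` {p}) = r `` {g s p}"
proof -
  have eq: "equiv P r" and comp: "\<And>a b. (a, b) \<in> r \<Longrightarrow> (g s a, g s b) \<in> r"
    using assms by (auto simp: act_congruence_def)
  have "r `` {g s q} = r `` {g s p}" if "q \<in> r `` {p}" for q
    using that comp[of p q] equiv_class_eq[OF eq] by blast
  moreover have "p \<in> r `` {p}"
    using eq \<open>p \<in> P\<close> by (rule equiv_class_self)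
  ultimately show ?thesis
    unfolding quotient_action_def by blast
qed

context monoid
begin

lemma free_right_action_closed:
  "s \<in> carrier G \<Longrightarrow> p \<in> free_act G X \<Longrightarrow> free_right_action G s p \<in> free_act G X"
  by (auto simp: free_right_action_def free_act_def)

text \<open>
  The two lemmas below exchange an isomorphism with a quotient of a free act for a map \<open>\<pi>\<close> from the
  free act onto \<open>A\<close>, so that later arguments speak of elements of \<open>A\<close> and not of classes.
\<close>

lemma presentation_of_finitely_presented_right_act:
  assumes fp: "finitely_presented_right_act G A f"
  obtains n :: nat and H \<pi> where
    "finite H" "H \<subseteq> free_act G {..<n} \<times> free_act G {..<n}"
    "\<pi> ` free_act G {..<n} = A"
    "\<And>s p. s \<in> carrier G \<Longrightarrow> p \<in> free_act G {..<n} \<Longrightarrow>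
      \<pi> (free_right_action G s p) = f s (\<pi> p)"
    "same_image (free_act G {..<n}) \<pi>
      = generated_congruence G (free_act G {..<n}) (free_right_action G) H"
proof -
  interpret A: right_act G A f
    using fp by (simp add: finitely_presented_right_act_def)
  from fp obtain n :: nat and r h H where H: "finite H"
      "H \<subseteq> free_act G {..<n} \<times> free_act G {..<n}"
      and r: "r = generated_congruence G (free_act G {..<n}) (free_right_action G) H"
      and bij: "bij_betw h A (free_act G {..<n} // r)"
      and hom: "\<And>s a. s \<in> carrier G \<Longrightarrow> a \<in> A \<Longrightarrow>
        h (f s a) = quotient_action r (free_right_action G) s (h a)"
    unfolding finitely_presented_right_act_def finitely_generated_congruence_def
      act_isomorphic_def by blast
  let ?F = "free_act G {..<n}"
  have cong: "act_congruence G ?F (free_right_action G) r"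
    unfolding r using H(2) free_right_action_closed
    by (intro act_congruence_generated_congruence) auto
  then have eq: "equiv ?F r" by (simp add: act_congruence_def)
  define \<pi> where "\<pi> p = inv_into A h (r `` {p})" for p
  have h_pi: "h (\<pi> p) = r `` {p}" and pi_A: "\<pi> p \<in> A" if "p \<in> ?F" for p
  proof -
    have "r `` {p} \<in> h ` A"
      using bij that by (auto simp: bij_betw_def intro: quotientI)
    then show "h (\<pi> p) = r `` {p}" "\<pi> p \<in> A"
      unfolding \<pi>_def by (rule f_inv_into_f, rule inv_into_into)
  qed
  have inj: "inj_on h A" using bij by (simp add: bij_betw_def)
  show ?thesis
  proof (rule that[OF H])
    show "\<pi> ` ?F = A"
    proof
      show "A \<subseteq> \<pi> ` ?F"
      proof
        fix a assume a: "a \<in> A"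
        then have "h a \<in> ?F // r" using bij by (auto simp: bij_betw_def)
        then obtain p where p: "p \<in> ?F" "h a = r `` {p}" by (auto elim: quotientE)
        then have "a = \<pi> p" using inj_onD[OF inj] a pi_A h_pi by simp
        with p show "a \<in> \<pi> ` ?F" by blast
      qed
    qed (use pi_A in blast)
    show "\<pi> (free_right_action G s p) = f s (\<pi> p)" if "s \<in> carrier G" "p \<in> ?F" for s p
    proof (rule inj_onD[OF inj])
      show "h (\<pi> (free_right_action G s p)) = h (f s (\<pi> p))"
        using that by (simp add: hom pi_A h_pi free_right_action_closed quotient_action_class[OF cong])
    qed (use that in \<open>auto intro: pi_A free_right_action_closed A.act_closed\<close>)
    have "(\<pi> p = \<pi> q) \<longleftrightarrow> (p, q) \<in> r" if "p \<in> ?F" "q \<in> ?F" for p q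
      using that h_pi[of p] h_pi[of q] eq_equiv_class_iff[OF eq, of p q] by (metis \<pi>_def)
    moreover have "r \<subseteq> ?F \<times> ?F" using eq by (simp add: equiv_def)
    ultimately have "same_image ?F \<pi> = r" by (auto simp: same_image_def)
    then show "same_image ?F \<pi> = generated_congruence G ?F (free_right_action G) H"
      by (simp add: r)
  qed
qed

lemma finitely_presented_right_actI:
  fixes n :: nat
  assumes "right_act G A f"
    and H: "finite H" "H \<subseteq> free_act G {..<n} \<times> free_act G {..<n}"
    and surj: "\<pi> ` free_act G {..<n} = A"
    and hom: "\<And>s p. s \<in> carrier G \<Longrightarrow> p \<in> free_act G {..<n} \<Longrightarrow>
      \<pi> (free_right_action G s p) = f s (\<pi> p)"
    and ker: "same_image (free_act G {..<n}) \<pi>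
      = generated_congruence G (free_act G {..<n}) (free_right_action G) H"
  shows "finitely_presented_right_act G A f"
proof -
  let ?F = "free_act G {..<n}"
  define r where "r = same_image ?F \<pi>"
  have cong: "act_congruence G ?F (free_right_action G) r"
    unfolding r_def using hom free_right_action_closed by (intro act_congruence_same_image) auto
  define h where "h a = {p \<in> ?F. \<pi> p = a}" for a
  have h_pi: "h (\<pi> p) = r `` {p}" if "p \<in> ?F" for p
    using that by (auto simp: h_def r_def same_image_def)
  have "inj_on h A"
  proof (rule inj_onI)
    fix a b assume "a \<in> A" "b \<in> A" "h a = h b"
    moreover obtain p where "p \<in> ?F" "\<pi> p = a"
      using surj \<open>a \<in> A\<close> by blast
    then have "p \<in> h a" by (simp add: h_def)
    ultimately show "a = b" using \<open>\<pi> p = a\<close> by (simp add: h_def)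
  qed
  moreover have "h ` A = ?F // r"
    unfolding quotient_def surj[symmetric] using h_pi by auto
  ultimately have "bij_betw h A (?F // r)" by (simp add: bij_betw_def)
  moreover have "h (f s a) = quotient_action r (free_right_action G) s (h a)"
    if "s \<in> carrier G" "a \<in> A" for s a
  proof -
    obtain p where p: "p \<in> ?F" "a = \<pi> p" using surj \<open>a \<in> A\<close> by blast
    have "h (f s a) = r `` {free_right_action G s p}"
      using p that by (simp add: h_pi hom[symmetric] free_right_action_closed)
    also have "\<dots> = quotient_action r (free_right_action G) s (h a)"
      using p that by (simp add: h_pi quotient_action_class[OF cong])
    finally show ?thesis .
  qed
  ultimately have "act_isomorphic G A f (?F // r) (quotient_action r (free_right_action G))"
    unfolding act_isomorphic_def by blast
  moreover have "finitely_generated_congruence G ?F (free_right_action G) r"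
    unfolding finitely_generated_congruence_def r_def ker using H by blast
  ultimately show ?thesis
    unfolding finitely_presented_right_act_def using assms(1) by blast
qed

end

section \<open>Colliding edges of an act over a free monoid\<close>

text \<open>
  These assumptions characterise the free monoid with basis \<open>L\<close> and word length \<open>len\<close>. They refer to
  last letters only, so that words and reversed words satisfy them alike, and the action of a product
  \<open>s \<otimes> x\<close> on a right act follows the edges of \<open>s\<close> and then one edge labelled \<open>x\<close>.
\<close>

locale letter_monoid = monoid S for S :: "('s, 'm) monoid_scheme" (structure) +
  fixes L :: "'s set" and len :: "'s \<Rightarrow> nat"
  assumes letters_closed: "L \<subseteq> carrier S"
    and len_one: "len \<one> = 0"
    and len_letter: "\<lbrakk>s \<in> carrier S; x \<in> L\<rbrakk> \<Longrightarrow> len (s \<otimes> x) = Suc (len s)"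
    and last_letter: "\<lbrakk>s \<in> carrier S; s \<noteq> \<one>\<rbrakk> \<Longrightarrow> \<exists>t\<in>carrier S. \<exists>x\<in>L. s = t \<otimes> x"
    and last_letter_unique:
      "\<lbrakk>s \<in> carrier S; t \<in> carrier S; x \<in> L; y \<in> L; s \<otimes> x = t \<otimes> y\<rbrakk> \<Longrightarrow> s = t \<and> x = y"
begin

definition colliding_edges :: "'b set \<Rightarrow> ('s \<Rightarrow> 'b \<Rightarrow> 'b) \<Rightarrow> ('b \<times> 's) set" where
  "colliding_edges A f =
     {(a, x). a \<in> A \<and> x \<in> L \<and> (\<exists>b\<in>A. \<exists>y\<in>L. (b, y) \<noteq> (a, x) \<and> f y b = f x a)}"

lemma letter_closed: "x \<in> L \<Longrightarrow> x \<in> carrier S"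
  using letters_closed by blast

text \<open>
  Instead of following chains of elementary steps, the proof exhibits a congruence \<open>r\<close> that contains
  the relations and whose definition already confines the last edges: related elements either have
  the same last edge or both have their last edge in the finite set \<open>K\<close> of those occurring in the
  relations. Acting by a letter on related elements produces the same new last edge, which is why \<open>r\<close>
  is compatible with the action. As the kernel of \<open>\<pi>\<close> is the least congruence containing the
  relations, it lies in \<open>r\<close>, so two different last edges with a common end both lie in \<open>K\<close>.
\<close>

lemma finite_colliding_edges:
  assumes fp: "finitely_presented_right_act S A f"
  shows "finite (colliding_edges A f)"
proof -
  obtain n :: nat and H \<pi> where
    H: "finite H" "H \<subseteq> free_act S {..<n} \<times> free_act S {..<n}"
    and surj: "\<pi> ` free_act S {..<n} = A"
    and hom: "\<And>s p. s \<in> carrier S \<Longrightarrow> p \<in> free_act S {..<n} \<Longrightarrow>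
      \<pi> (free_right_action S s p) = f s (\<pi> p)"
    and ker: "same_image (free_act S {..<n}) \<pi>
      = generated_congruence S (free_act S {..<n}) (free_right_action S) H"
    using presentation_of_finitely_presented_right_act[OF fp] by metis
  let ?F = "free_act S {..<n}" and ?g = "free_right_action S"
  \<comment> \<open>The last edge is taken in \<open>A\<close>, as a set with at most one member: it is empty for empty words.\<close>
  define last_edge where
    "last_edge q = {(\<pi> p, x) | p x. p \<in> ?F \<and> x \<in> L \<and> q = ?g x p}" for q
  have last_edge_snoc: "last_edge (?g x p) = {(\<pi> p, x)}" if "p \<in> ?F" "x \<in> L" for p x
  proof -
    have "q = p \<and> y = x" if "q \<in> ?F" "y \<in> L" "?g x p = ?g y q" for q y
      using that \<open>p \<in> ?F\<close> \<open>x \<in> L\<close> last_letter_unique[of "snd p" "snd q" x y]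
      by (auto simp: free_right_action_def free_act_def)
    then show ?thesis
      using that unfolding last_edge_def by blast
  qed
  define K where "K = last_edge ` (Domain H \<union> Range H)"
  have finK: "finite K" using H(1) by (simp add: K_def finite_Domain finite_Range)
  define r where
    "r = {(p, q). (p, q) \<in> same_image ?F \<pi> \<and>
            (last_edge p = last_edge q \<or> last_edge p \<in> K \<and> last_edge q \<in> K)}"
  have same_cong: "act_congruence S ?F ?g (same_image ?F \<pi>)"
    using hom free_right_action_closed by (intro act_congruence_same_image) auto
  have "equiv ?F r"
  proof (rule equivI)
    show "r \<subseteq> ?F \<times> ?F" "refl_on ?F r" by (auto simp: r_def same_image_def refl_on_def)
    show "sym r" by (rule symI) (simp add: r_def same_image_def, metis)
    show "trans r" by (rule transI) (simp add: r_def same_image_def, metis)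
  qed
  moreover have "(?g s p, ?g s q) \<in> r" if s: "s \<in> carrier S" and pq: "(p, q) \<in> r" for s p q
  proof (cases "s = \<one>")
    case True
    then have "?g s p = p" "?g s q = q"
      using pq by (auto simp: r_def same_image_def free_act_def free_right_action_def)
    then show ?thesis using pq by simp
  next
    case False
    then obtain t x where t: "t \<in> carrier S" "x \<in> L" "s = t \<otimes> x"
      using last_letter s by blast
    have pq': "p \<in> ?F" "q \<in> ?F" "\<pi> p = \<pi> q"
      using pq by (auto simp: r_def same_image_def)
    have split: "?g s u = ?g x (?g t u)" if "u \<in> ?F" for u
      using that t letter_closed
      by (auto simp: free_act_def free_right_action_def m_assoc)
    have "last_edge (?g s p) = last_edge (?g s q)"
      using pq' t(1,2) by (simp add: split last_edge_snoc free_right_action_closed hom)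
    moreover have "(?g s p, ?g s q) \<in> same_image ?F \<pi>"
      using same_cong s pq unfolding act_congruence_def r_def by blast
    ultimately show ?thesis by (simp add: r_def)
  qed
  ultimately have "act_congruence S ?F ?g r"
    by (simp add: act_congruence_def)
  moreover have "H \<subseteq> r"
    using subset_generated_congruence[of H S ?F ?g] by (auto simp: r_def ker K_def)
  ultimately have sub: "same_image ?F \<pi> \<subseteq> r"
    unfolding ker by (rule generated_congruence_least)
  have "{e} \<in> K" if e: "e \<in> colliding_edges A f" for e
  proof -
    obtain a x b y where e: "e = (a, x)" "a \<in> A" "x \<in> L" "b \<in> A" "y \<in> L"
      "(b, y) \<noteq> (a, x)" "f y b = f x a"
      using e by (auto simp: colliding_edges_def)
    obtain p q where pq: "p \<in> ?F" "a = \<pi> p" "q \<in> ?F" "b = \<pi> q"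
      using surj e by blast
    have "(?g x p, ?g y q) \<in> same_image ?F \<pi>"
      using e pq by (simp add: same_image_def free_right_action_closed letter_closed hom)
    with sub have "(?g x p, ?g y q) \<in> r" by blast
    then show ?thesis
      using e pq by (auto simp: r_def last_edge_snoc)
  qed
  then have "(\<lambda>e. {e}) ` colliding_edges A f \<subseteq> K" by blast
  then show ?thesis
    using finK inj_on_finite[of "\<lambda>e. {e}"] by (auto simp: inj_on_def)
qed

text \<open>
  Every element \<open>a\<close> gets a shortest representative \<open>nf a\<close> in the free act on the generators, and the
  relations identify \<open>nf b \<otimes> y\<close> with \<open>nf (by)\<close> for the finitely many edges \<open>(b, y)\<close> in \<open>E\<close>. The heart of
  the proof is that they make every element \<open>p\<close> of the free act equivalent to \<open>nf (\<pi> p)\<close>, by induction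
  on the length of \<open>p\<close>. Minimality of the chosen representatives is what lets the induction
  hypothesis apply to \<open>nf (\<pi> p)\<close> without its last letter, too.
\<close>

lemma finitely_presented_if_finite_colliding_edges:
  assumes act: "right_act S A f" and fg: "finitely_generated_act S A f"
    and fin: "finite (colliding_edges A f)"
  shows "finitely_presented_right_act S A f"
proof -
  interpret A: right_act S A f by (fact act)
  obtain X where X: "finite X" "X \<subseteq> A" "generated_subact S A f X = A"
    using fg by (auto simp: finitely_generated_act_def)
  obtain n :: nat and gen where gen: "bij_betw gen {..<n} X"
    using ex_bij_betw_nat_finite[OF X(1)] by (auto simp: atLeast0LessThan)
  let ?F = "free_act S {..<n}" and ?g = "free_right_action S"
  define \<pi> where "\<pi> p = f (snd p) (gen (fst p))" for p
  have gen_A: "gen i \<in> A" if "i < n" for i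
    using gen that X(2) by (auto simp: bij_betw_def)
  have hom: "\<pi> (?g s p) = f s (\<pi> p)" if "s \<in> carrier S" "p \<in> ?F" for s p
    using that by (auto simp: \<pi>_def free_act_def free_right_action_def A.act_mult gen_A)
  have gen_image: "\<pi> (i, \<one>) = gen i" if "i < n" for i
    using that by (simp add: \<pi>_def A.act_one gen_A)
  have surj: "\<pi> ` ?F = A"
  proof
    show "\<pi> ` ?F \<subseteq> A"
      by (auto simp: \<pi>_def free_act_def intro!: A.act_closed gen_A)
    then have "subact S A f (\<pi> ` ?F)"
      using hom free_right_action_closed by (force simp: subact_def)
    moreover have "X \<subseteq> \<pi> ` ?F"
    proof
      fix x assume "x \<in> X"
      then obtain i where i: "i < n" "x = gen i" using gen by (auto simp: bij_betw_def)
      then have "x = \<pi> (i, \<one>)" "(i, \<one>) \<in> ?F"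
        by (auto simp: gen_image free_act_def)
      then show "x \<in> \<pi> ` ?F" by blast
    qed
    ultimately have "generated_subact S A f X \<subseteq> \<pi> ` ?F"
      by (auto simp: generated_subact_def)
    then show "A \<subseteq> \<pi> ` ?F" by (simp add: X(3))
  qed
  define nf where "nf a = arg_min (\<lambda>p. len (snd p)) (\<lambda>p. p \<in> ?F \<and> \<pi> p = a)" for a
  have nf: "nf a \<in> ?F" "\<pi> (nf a) = a"
    and nf_min: "\<And>p. p \<in> ?F \<Longrightarrow> \<pi> p = a \<Longrightarrow> len (snd (nf a)) \<le> len (snd p)" if "a \<in> A" for a
  proof -
    obtain q where "q \<in> ?F \<and> \<pi> q = a" using surj \<open>a \<in> A\<close> by blast
    then have "nf a \<in> ?F \<and> \<pi> (nf a) = a"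
      unfolding nf_def by (rule arg_min_natI)
    then show "nf a \<in> ?F" "\<pi> (nf a) = a" by auto
    show "len (snd (nf a)) \<le> len (snd p)" if "p \<in> ?F" "\<pi> p = a" for p
      unfolding nf_def using that by (auto intro: arg_min_nat_le)
  qed
  define into where "into x = {(b, y). b \<in> A \<and> y \<in> L \<and> f y b = x}" for x
  have fin_into: "finite (into x)" for x
  proof (cases "into x \<subseteq> colliding_edges A f")
    case True
    then show ?thesis using fin finite_subset by blast
  next
    case False
    \<comment> \<open>An edge into \<open>x\<close> that does not collide is the only one.\<close>
    then obtain e where "e \<in> into x" "e \<notin> colliding_edges A f" by blast
    then have "into x \<subseteq> {e}"
      by (auto simp: into_def colliding_edges_def)
    then show ?thesis by (rule finite_subset) simp
  qed
  \<comment> \<open>Edges into generators matter because the chosen representative of a generator is an empty word,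
    which does not use any of them.\<close>
  define E where "E = colliding_edges A f \<union> (\<Union>x\<in>X. into x)"
  define H where "H = (\<lambda>(b, y). (?g y (nf b), nf (f y b))) ` E"
  have E_edge: "b \<in> A" "y \<in> L" if "(b, y) \<in> E" for b y
    using that by (auto simp: E_def into_def colliding_edges_def)
  have finH: "finite H"
    unfolding H_def E_def using fin fin_into X(1) by simp
  have H_F: "H \<subseteq> same_image ?F \<pi>"
    using E_edge
    by (auto simp: H_def same_image_def nf letter_closed A.act_closed free_right_action_closed hom)
  then have H_FF: "H \<subseteq> ?F \<times> ?F" by (auto simp: same_image_def)
  let ?r = "generated_congruence S ?F ?g H"
  have cong: "act_congruence S ?F ?g ?r"
    using H_FF free_right_action_closed by (intro act_congruence_generated_congruence) auto
  then have r_equiv: "refl_on ?F ?r" "sym ?r" "trans ?r"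
    and r_comp: "\<And>s p q. s \<in> carrier S \<Longrightarrow> (p, q) \<in> ?r \<Longrightarrow> (?g s p, ?g s q) \<in> ?r"
    by (auto simp: act_congruence_def equiv_def)
  have to_nf: "p \<in> ?F \<Longrightarrow> (p, nf (\<pi> p)) \<in> ?r" for p
  proof (induction "len (snd p)" arbitrary: p rule: less_induct)
    case less
    obtain i u where p: "p = (i, u)" "i < n" "u \<in> carrier S"
      using less.prems by (auto simp: free_act_def)
    show ?case
    proof (cases "u = \<one>")
      case True
      \<comment> \<open>Distinct generators of the free act have distinct images, so \<open>p\<close> is the only empty
        word that represents \<open>\<pi> p\<close>.\<close>
      have "len (snd (nf (\<pi> p))) = 0"
        using nf_min[of "\<pi> p" p] less.prems surj True p by (auto simp: len_one)
      obtain j v where q: "nf (\<pi> p) = (j, v)" "j < n" "v \<in> carrier S"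
        using nf(1)[of "\<pi> p"] less.prems surj by (auto simp: free_act_def)
      have "v = \<one>"
        using \<open>len (snd (nf (\<pi> p))) = 0\<close> q last_letter len_letter by fastforce
      then have "gen j = gen i"
        using nf(2)[of "gen i"] gen_A p q True \<open>v = \<one>\<close> by (simp add: gen_image)
      then have "j = i" using gen q p by (auto simp: bij_betw_def inj_on_def)
      then have "nf (\<pi> p) = p" using q p True \<open>v = \<one>\<close> by simp
      then show ?thesis using r_equiv(1) less.prems by (simp add: refl_on_def)
    next
      case False
      then obtain t y where t: "t \<in> carrier S" "y \<in> L" "u = t \<otimes> y"
        using last_letter p by blast
      define p' where "p' = (i, t)"
      have p': "p' \<in> ?F" "p = ?g y p'" "len (snd p) = Suc (len (snd p'))"
        using p t by (auto simp: p'_def free_act_def free_right_action_def len_letter)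
      define b where "b = \<pi> p'"
      have b: "b \<in> A" "\<pi> p = f y b"
        using p' surj t letter_closed by (auto simp: b_def hom)
      have "(p', nf b) \<in> ?r" using less.hyps[of p'] p' by (simp add: b_def)
      then have p_step: "(p, ?g y (nf b)) \<in> ?r"
        using r_comp t letter_closed p'(2) by blast
      have "(?g y (nf b), nf (f y b)) \<in> ?r"
      proof (cases "(b, y) \<in> E")
        case True
        then have "(?g y (nf b), nf (f y b)) \<in> H" by (force simp: H_def)
        then show ?thesis using subset_generated_congruence by blast
      next
        case False
        \<comment> \<open>The representative of \<open>by\<close> also arrives along the edge \<open>(b, y)\<close>, since no other edge ends
          there; so it is \<open>q'\<close> followed by \<open>y\<close> for some representative \<open>q'\<close> of \<open>b\<close>.\<close>
        have fyb: "f y b \<in> A" "f y b \<notin> X"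
          using False b t letter_closed by (auto simp: E_def into_def intro: A.act_closed)
        obtain j v where q: "nf (f y b) = (j, v)" "j < n" "v \<in> carrier S"
          using nf(1)[OF fyb(1)] by (auto simp: free_act_def)
        have "v \<noteq> \<one>"
        proof
          assume "v = \<one>"
          then have "f y b = gen j" using nf(2)[OF fyb(1)] q by (simp add: gen_image)
          then show False using fyb(2) gen q by (auto simp: bij_betw_def)
        qed
        then obtain w z where w: "w \<in> carrier S" "z \<in> L" "v = w \<otimes> z"
          using last_letter q by blast
        define q' where "q' = (j, w)"
        have q': "q' \<in> ?F" "nf (f y b) = ?g z q'" "len (snd (nf (f y b))) = Suc (len (snd q'))"
          using q w by (auto simp: q'_def free_act_def free_right_action_def len_letter)
        have "f z (\<pi> q') = f y b"
          using nf(2)[OF fyb(1)] q' w letter_closed by (simp add: hom)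
        moreover have "\<pi> q' \<in> A" using q' surj by blast
        ultimately have same: "\<pi> q' = b" "z = y"
          using False b t w by (auto simp: E_def colliding_edges_def)
        have "len (snd (nf (f y b))) \<le> len (snd p)"
          using nf_min[OF fyb(1) less.prems] b by simp
        then have "len (snd q') < len (snd p)" using q'(3) by simp
        then have "(q', nf b) \<in> ?r" using less.hyps q'(1) same by blast
        then have "(?g y q', ?g y (nf b)) \<in> ?r" using r_comp t letter_closed by blast
        then show ?thesis using q' same r_equiv(2) by (auto dest: symD)
      qed
      then show ?thesis using p_step r_equiv(3) b by (auto dest: transD)
    qed
  qed
  have "same_image ?F \<pi> = ?r"
  proof
    show "?r \<subseteq> same_image ?F \<pi>"
      using H_F hom free_right_action_closed
      by (intro generated_congruence_least act_congruence_same_image) auto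
    show "same_image ?F \<pi> \<subseteq> ?r"
    proof clarify
      fix p q assume "(p, q) \<in> same_image ?F \<pi>"
      then have "(p, nf (\<pi> p)) \<in> ?r" "(q, nf (\<pi> p)) \<in> ?r"
        using to_nf[of p] to_nf[of q] by (auto simp: same_image_def)
      then show "(p, q) \<in> ?r" using r_equiv by (meson symD transD)
    qed
  qed
  then show ?thesis
    using finitely_presented_right_actI[OF act finH H_FF surj hom] by blast
qed

theorem finitely_presented_right_act_iff:
  assumes "right_act S A f" and "finitely_generated_act S A f"
  shows "finitely_presented_right_act S A f \<longleftrightarrow> finite (colliding_edges A f)"
  using assms finite_colliding_edges finitely_presented_if_finite_colliding_edges by blast

text \<open>An edge that collides in a subact collides in the act, so the criterion is inherited.\<close>

theorem letter_monoid_right_coherent: "right_coherent TYPE('b) S"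
  unfolding right_coherent_def
proof (intro conjI allI impI; (elim conjE)?)
  show "monoid S" by (rule monoid_axioms)
  fix A B :: "'b set" and f
  assume fp: "finitely_presented_right_act S A f" and sub: "subact S A f B"
    and fg: "finitely_generated_act S B f"
  interpret A: right_act S A f
    using fp by (simp add: finitely_presented_right_act_def)
  have B: "right_act S B f"
    by unfold_locales (use sub in \<open>auto simp: subact_def intro: A.act_one A.act_mult\<close>)
  have "colliding_edges B f \<subseteq> colliding_edges A f"
    using sub by (auto simp: subact_def colliding_edges_def)
  with finite_colliding_edges[OF fp] have "finite (colliding_edges B f)"
    by (rule rev_finite_subset)
  then show "finitely_presented_right_act S B f"
    using finitely_presented_right_act_iff[OF B fg] by blast
qed

end

section \<open>Left acts as right acts over the opposite monoid\<close>

definition opposite_monoid :: "('s, 'm) monoid_scheme \<Rightarrow> 's monoid" where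
  "opposite_monoid S = \<lparr>carrier = carrier S, mult = (\<lambda>s t. t \<otimes>\<^bsub>S\<^esub> s), one = \<one>\<^bsub>S\<^esub>\<rparr>"

lemma carrier_opposite_monoid [simp]: "carrier (opposite_monoid S) = carrier S"
  by (simp add: opposite_monoid_def)

context monoid
begin

lemma monoid_opposite_monoid: "monoid (opposite_monoid G)"
  by (rule monoidI) (auto simp: opposite_monoid_def m_assoc)

text \<open>
  Apart from the law for products and the action on free acts, all notions involved in coherence
  depend on the monoid through its carrier only, which the opposite monoid shares.
\<close>

lemma right_act_opposite_monoid_iff: "right_act (opposite_monoid G) A f \<longleftrightarrow> left_act G A f"
  using monoid_opposite_monoid monoid_axioms
  unfolding right_act_def left_act_def right_act_axioms_def left_act_axioms_def
  by (auto simp: opposite_monoid_def)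

lemma finitely_presented_right_act_opposite_monoid_iff:
  "finitely_presented_right_act (opposite_monoid G) A f \<longleftrightarrow> finitely_presented_left_act G A f"
proof -
  have "free_right_action (opposite_monoid G) = (free_left_action G :: _ \<Rightarrow> nat \<times> _ \<Rightarrow> _)"
    by (simp add: free_right_action_def free_left_action_def opposite_monoid_def fun_eq_iff)
  then show ?thesis
    by (simp add: finitely_presented_right_act_def finitely_presented_left_act_def
        right_act_opposite_monoid_iff free_act_def act_isomorphic_def
        finitely_generated_congruence_def generated_congruence_def act_congruence_def)
qed

lemma right_coherent_opposite_monoid_iff:
  "right_coherent TYPE('c) (opposite_monoid G) \<longleftrightarrow> left_coherent TYPE('c) G"
  using monoid_opposite_monoid monoid_axioms
  by (simp add: right_coherent_def left_coherent_def subact_def finitely_generated_act_def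
      generated_subact_def finitely_presented_right_act_opposite_monoid_iff)

end

section \<open>Coherence of free monoids\<close>

lemma letter_monoid_free_monoid:
  "letter_monoid (free_monoid \<Omega>) ((\<lambda>x. [x]) ` \<Omega>) length"
proof -
  have "\<exists>t\<in>lists \<Omega>. \<exists>x\<in>\<Omega>. s = t @ [x]" if "s \<in> lists \<Omega>" "s \<noteq> []" for s
    using that by (cases s rule: rev_cases) auto
  then show ?thesis
    by (intro letter_monoid.intro monoid_free_monoid letter_monoid_axioms.intro)
      (auto simp: free_monoid_def)
qed

text \<open>In the opposite monoid, the last letter of a word is the head of the list.\<close>

lemma letter_monoid_opposite_free_monoid:
  "letter_monoid (opposite_monoid (free_monoid \<Omega>)) ((\<lambda>x. [x]) ` \<Omega>) length"
proof -
  have "\<exists>t\<in>lists \<Omega>. \<exists>x\<in>\<Omega>. s = x # t" if "s \<in> lists \<Omega>" "s \<noteq> []" for s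
    using that by (cases s) auto
  then show ?thesis
    by (intro letter_monoid.intro monoid.monoid_opposite_monoid monoid_free_monoid
        letter_monoid_axioms.intro)
      (auto simp: free_monoid_def opposite_monoid_def)
qed

theorem theorem1:
  fixes \<Omega> :: "'a set"
  shows "coherent TYPE('b) (free_monoid \<Omega>)"
proof -
  interpret right: letter_monoid "free_monoid \<Omega>" "(\<lambda>x. [x]) ` \<Omega>" length
    by (rule letter_monoid_free_monoid)
  interpret left: letter_monoid "opposite_monoid (free_monoid \<Omega>)" "(\<lambda>x. [x]) ` \<Omega>" length
    by (rule letter_monoid_opposite_free_monoid)
  show ?thesis
    unfolding coherent_def
    using right.letter_monoid_right_coherent left.letter_monoid_right_coherent
      right.right_coherent_opposite_monoid_iff by blast
qed

end
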